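(* Let $(\mathcal{E},\tau)$ be a Hausdorff topological vector space and let $\mathscr{C}$ be a nonempty $\tau$-compact convex subset of $\mathcal{E}$. Assume that there exists an admissible function for $\mathscr{C}$ on $\mathcal{E}$. Then $\mathscr{C}$ has the $\tau$-approximate fixed point property; that is, for every Hausdorff vector topology $\sigma$ on $\mathcal{E}$ and every sequentially continuous mapping $f\colon(\mathscr{C},\sigma)\to(\mathscr{C},\tau)$ there is a sequence $\{x_n\}$ in $\mathscr{C}$ such that $x_n-f(x_n)\to 0$ in $(\mathcal{E},\tau)$.
   Context: A Hausdorff vector topology on $\mathcal{E}$ is a Hausdorff topology making the vector space $\mathcal{E}$ a topological vector space; no relation between $\sigma$ and $\tau$ is assumed. $(\mathscr{C},\sigma)$ and $(\mathscr{C},\tau)$ denote $\mathscr{C}$ with the corresponding subspace topologies. A mapping $f\colon X\to Y$ between topological spaces is sequentially continuous if $x_n\to x$ in $X$ implies $f(x_n)\to f(x)$ in $Y$ for every sequence $\{x_n\}$ in $X$ and every $x\in X$. An admissible function for $\mathscr{C}$ on $\mathcal{E}$ is a function $\rho\colon\mathcal{E}\to[0,\infty]$ such that: (i) the mapping $(x,y)\mapsto\rho(x-y)$ is continuous on $\mathscr{C}\times\mathscr{C}$ (with the topology induced by $\tau$), with values in $[0,\infty]$; (ii) $\rho(x+y)\le\rho(x)+\rho(y)$ for all $x,y\in\mathcal{E}$; (iii) $\rho(\lambda x)=|\lambda|\rho(x)$ for all $\lambda\in\mathbb{R}$ and $x\in\mathcal{E}$ (with the convention $0\cdot\infty=0$);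 (iv) if $x,y\in\mathscr{C}$ and $\rho(x-y)=0$, then $x=y$. *)

theory Defs
  imports "HOL-Analysis.Analysis"
begin

text \<open>
  Two unrelated topologies on one vector space are compared, so topologies are values of type
  \<^typ>\<open>'a topology\<close> on a carrier of class \<^class>\<open>real_vector\<close>, not type class instances.
\<close>

definition vector_topology :: "'a::real_vector topology \<Rightarrow> bool" where
  "vector_topology T \<longleftrightarrow>
     topspace T = UNIV \<and>
     continuous_map (prod_topology T T) T (\<lambda>(x, y). x + y) \<and>
     continuous_map (prod_topology euclideanreal T) T (\<lambda>(c, x). c *\<^sub>R x)"

definition hausdorff_vector_topology :: "'a::real_vector topology \<Rightarrow> bool" where
  "hausdorff_vector_topology T \<longleftrightarrow> vector_topology T \<and> Hausdorff_space T"

definition sequentially_continuous_map ::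
    "'a topology \<Rightarrow> 'b topology \<Rightarrow> ('a \<Rightarrow> 'b) \<Rightarrow> bool" where
  "sequentially_continuous_map X Y f \<longleftrightarrow>
     f \<in> topspace X \<rightarrow> topspace Y \<and>
     (\<forall>u x. range u \<subseteq> topspace X \<longrightarrow> limitin X u x sequentially \<longrightarrow>
        limitin Y (\<lambda>n. f (u n)) (f x) sequentially)"

text \<open>
  Values lie in \<^typ>\<open>ennreal\<close>, i.e. in the extended half-line with its order topology; there
  \<^prop>\<open>0 * \<infinity> = (0::ennreal)\<close>, which is the convention needed for homogeneity.
\<close>

definition admissible_function ::
    "'a::real_vector topology \<Rightarrow> 'a set \<Rightarrow> ('a \<Rightarrow> ennreal) \<Rightarrow> bool" where
  "admissible_function \<tau> C \<rho> \<longleftrightarrow>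
     continuous_map (prod_topology (subtopology \<tau> C) (subtopology \<tau> C)) euclidean
       (\<lambda>(x, y). \<rho> (x - y)) \<and>
     (\<forall>x y. \<rho> (x + y) \<le> \<rho> x + \<rho> y) \<and>
     (\<forall>(c::real) x. \<rho> (c *\<^sub>R x) = ennreal \<bar>c\<bar> * \<rho> x) \<and>
     (\<forall>x\<in>C. \<forall>y\<in>C. \<rho> (x - y) = 0 \<longrightarrow> x = y)"

definition approximate_fixed_point_property ::
    "'a::real_vector topology \<Rightarrow> 'a set \<Rightarrow> bool" where
  "approximate_fixed_point_property \<tau> C \<longleftrightarrow>
     (\<forall>\<sigma> f. hausdorff_vector_topology \<sigma> \<longrightarrow>
        sequentially_continuous_map (subtopology \<sigma> C) (subtopology \<tau> C) f \<longrightarrow>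
        (\<exists>u::nat \<Rightarrow> 'a. range u \<subseteq> C \<and> limitin \<tau> (\<lambda>n. u n - f (u n)) 0 sequentially))"

end

theory Submission
  imports Defs
begin

text \<open>
  Fix a finite net \<open>y\<^sub>i\<close> of \<open>C\<close> for \<open>\<rho>\<close>. The map \<open>P \<circ> f\<close>, with \<open>P\<close> the Schauder projection
  onto the convex hull of the net, pulls back along the barycentric parametrisation to a
  self-map of a cube of coefficients. The parametrisation is continuous into \<open>\<sigma>\<close> for every vector
  topology \<open>\<sigma>\<close>, and the cube is metrizable, so sequential continuity of \<open>f\<close> makes the pulled back
  map continuous. Its Brouwer fixed point gives \<open>x\<close> with \<open>x = P (f x)\<close>, hence \<open>\<rho> (x - f x)\<close> is
  small. By compactness of \<open>C \<times> C\<close>, smallness of \<open>\<rho> (x - y)\<close> forces \<open>x - y\<close> to be close to \<open>0\<close>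
  in \<open>\<tau>\<close>.
\<close>

section \<open>Brouwer's theorem on the Hilbert cube\<close>

lemma tendsto_coordinatewise_iff:
  fixes u :: "'b \<Rightarrow> 'i \<Rightarrow> 'c::topological_space"
  shows "(u \<longlongrightarrow> x) F \<longleftrightarrow> (\<forall>i. ((\<lambda>n. u n i) \<longlongrightarrow> x i) F)"
  using limitin_componentwise[of "\<lambda>_. euclidean" UNIV u x F]
  by (simp add: euclidean_product_topology)

text \<open>
  The library's Brouwer theorem has the dimension in the type, but here it depends on the size of
  the net. On the Hilbert cube no dimension is needed: apply Kuhn's lemma to the first \<open>n\<close>
  coordinates with mesh \<open>1 / (n + 1)\<close> and pass to a limit point.
\<close>

lemma brouwer_Hilbert_cube:
  fixes f :: "(nat \<Rightarrow> real) \<Rightarrow> nat \<Rightarrow> real"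
  defines "Q \<equiv> {x. \<forall>i. x i \<in> {0..1}}"
  assumes cont: "continuous_on Q f" and self: "f ` Q \<subseteq> Q"
  obtains x where "x \<in> Q" "f x = x"
proof -
  have "compactin (product_topology (\<lambda>_. euclidean) UNIV) (\<Pi>\<^sub>E i\<in>(UNIV::nat set). {0..1::real})"
    by (simp add: compactin_PiE)
  moreover have "(\<Pi>\<^sub>E i\<in>(UNIV::nat set). {0..1::real}) = Q"
    by (auto simp: Q_def PiE_def Pi_def)
  ultimately have "compact Q"
    by (simp add: euclidean_product_topology)
  then have seq: "seq_compact Q"
    by (rule compact_imp_seq_compact)
  have bounds: "0 \<le> x i" "x i \<le> 1" "0 \<le> f x i" "f x i \<le> 1" if "x \<in> Q" for x i
    using that subsetD[OF self imageI[OF that]] by (simp_all add: Q_def)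
  \<comment> \<open>Kuhn labels: \<open>0\<close> where \<open>f\<close> does not decrease
    coordinate \<open>i\<close>, else \<open>1\<close>. Points with \<open>x i = 1\<close> get
    \<open>1\<close> by fiat, as Kuhn's lemma demands on the upper face; on \<open>Q\<close> the
    inequality \<open>f x i \<le> x i\<close> holds there anyway.\<close>
  define l :: "(nat \<Rightarrow> real) \<Rightarrow> nat \<Rightarrow> nat" where "l x i = (if x i \<le> f x i \<and> x i \<noteq> 1 then 0 else 1)" for x i
  have l: "l x i = 0 \<or> l x i = 1" "x i = 1 \<Longrightarrow> l x i = 1" "l x i = 0 \<Longrightarrow> x i \<le> f x i" for x i
    by (simp_all add: l_def split: if_splits)
  have l_zero: "l x i = 0" if "x \<in> Q" "x i = 0" for x i
    using bounds(3)[OF that(1), of i] that(2) by (simp add: l_def)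
  have l_one: "f x i \<le> x i" if "x \<in> Q" "l x i = 1" for x i
    using bounds(4)[OF that(1), of i] that(2) by (cases "x i = 1") (simp_all add: l_def split: if_splits)
  \<comment> \<open>\<open>z\<close> will be the lowest corner of the cell found by Kuhn's lemma;
    \<open>a\<close> and \<open>b\<close> are vertices of that cell whose \<open>i\<close>-th labels
    are \<open>0\<close> and \<open>1\<close>.\<close>
  have "\<exists>z\<in>Q. \<forall>i<n. \<exists>a\<in>Q. \<exists>b\<in>Q. (\<forall>j. \<bar>a j - z j\<bar> \<le> inverse (real (Suc n))) \<and>
      (\<forall>j. \<bar>b j - z j\<bar> \<le> inverse (real (Suc n))) \<and> a i \<le> f a i \<and> f b i \<le> b i" for n
  proof -
    \<comment> \<open>Grid of mesh \<open>1 / Suc n\<close> in the first \<open>n\<close>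
      coordinates, the others frozen at \<open>0\<close>. Kuhn's lemma wants a positive number of
      subdivisions, and \<open>Suc n\<close> is positive also for \<open>n = 0\<close>.\<close>
    define g where "g x = (\<lambda>j. if j < n then real (x j) / real (Suc n) else 0)" for x :: "nat \<Rightarrow> nat"
    have gQ: "g x \<in> Q" if "\<forall>i<n. x i \<le> Suc n" for x
      using that by (fastforce simp: g_def Q_def divide_le_eq_1)
    have "\<forall>x. (\<forall>i<n. x i \<le> Suc n) \<longrightarrow> (\<forall>i<n. l (g x) i = 0 \<or> l (g x) i = 1)"
      using l(1) by simp
    moreover have "\<forall>x. (\<forall>i<n. x i \<le> Suc n) \<longrightarrow> (\<forall>i<n. x i = 0 \<longrightarrow> l (g x) i = 0)"
      by (intro allI impI l_zero gQ) (auto simp: g_def)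
    moreover have "\<forall>x. (\<forall>i<n. x i \<le> Suc n) \<longrightarrow> (\<forall>i<n. x i = Suc n \<longrightarrow> l (g x) i = 1)"
      by (intro allI impI l(2)) (auto simp: g_def)
    ultimately obtain q where q: "\<forall>i<n. q i < Suc n"
      "\<forall>i<n. \<exists>r s. (\<forall>j<n. q j \<le> r j \<and> r j \<le> q j + 1) \<and> (\<forall>j<n. q j \<le> s j \<and> s j \<le> q j + 1) \<and>
         l (g r) i \<noteq> l (g s) i"
      by (rule kuhn_lemma[OF zero_less_Suc])
    have close: "\<bar>g r j - g q j\<bar> \<le> inverse (real (Suc n))" if "\<forall>j<n. q j \<le> r j \<and> r j \<le> q j + 1" for r j
    proof (cases "j < n")
      case True
      with that have "q j \<le> r j" "r j \<le> q j + 1" by auto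
      then have "\<bar>real (r j) - real (q j)\<bar> \<le> 1" by linarith
      then show ?thesis
        using True divide_right_mono[of "\<bar>real (r j) - real (q j)\<bar>" 1 "real (Suc n)"]
        by (simp add: g_def inverse_eq_divide abs_divide del: of_nat_Suc flip: diff_divide_distrib)
    qed (simp add: g_def)
    have inQ: "g r \<in> Q" if "\<forall>j<n. q j \<le> r j \<and> r j \<le> q j + 1" for r
      using that q(1) by (intro gQ) fastforce
    show ?thesis
    proof (rule bexI[of _ "g q"], intro allI impI)
      fix i assume "i < n"
      from q(2)[rule_format, OF this] obtain r s where rs: "\<forall>j<n. q j \<le> r j \<and> r j \<le> q j + 1" "\<forall>j<n. q j \<le> s j \<and> s j \<le> q j + 1"
        "l (g r) i \<noteq> l (g s) i"
        by blast
      then consider "l (g r) i = 0" "l (g s) i = 1" | "l (g s) i = 0" "l (g r) i = 1"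
        using l(1)[of "g r" i] l(1)[of "g s" i] by metis
      then show "\<exists>a\<in>Q. \<exists>b\<in>Q. (\<forall>j. \<bar>a j - g q j\<bar> \<le> inverse (real (Suc n))) \<and>
        (\<forall>j. \<bar>b j - g q j\<bar> \<le> inverse (real (Suc n))) \<and> a i \<le> f a i \<and> f b i \<le> b i"
      proof cases
        case 1
        show ?thesis
          by (intro bexI[of _ "g r"] bexI[of _ "g s"] conjI allI close rs inQ l(3) l_one 1)
      next
        case 2
        show ?thesis
          by (intro bexI[of _ "g s"] bexI[of _ "g r"] conjI allI close rs inQ l(3) l_one 2)
      qed
    qed (use q(1) in \<open>auto intro!: gQ less_imp_le\<close>)
  qed
  then obtain z where zQ: "\<And>n. z n \<in> Q" and z: "\<And>n i. i < n \<Longrightarrow> \<exists>a\<in>Q. \<exists>b\<in>Q.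
      (\<forall>j. \<bar>a j - z n j\<bar> \<le> inverse (real (Suc n))) \<and>
      (\<forall>j. \<bar>b j - z n j\<bar> \<le> inverse (real (Suc n))) \<and> a i \<le> f a i \<and> f b i \<le> b i"
    by metis
  obtain x k where x: "x \<in> Q" and k: "strict_mono k" and lim: "(z \<circ> k) \<longlonglongrightarrow> x"
    using seq zQ unfolding seq_compact_def by blast
  have coord: "(\<lambda>n. u n j) \<longlonglongrightarrow> y j" if "u \<longlonglongrightarrow> y" for u :: "nat \<Rightarrow> nat \<Rightarrow> real" and y j
    using that by (simp add: tendsto_coordinatewise_iff)
  \<comment> \<open>A sequence of vertices stays within the mesh of \<open>z\<close> and inherits
    its limit along \<open>k\<close>. Closeness is asked only for \<open>n > i\<close>, since the
    vertices for coordinate \<open>i\<close> are available only then.\<close>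
  have flim: "(\<lambda>n. c (k n)) \<longlonglongrightarrow> x \<and> (\<lambda>n. f (c (k n))) \<longlonglongrightarrow> f x"
    if cQ: "\<And>n. c n \<in> Q" and c: "\<And>n j. n > i \<Longrightarrow> \<bar>c n j - z n j\<bar> \<le> inverse (real (Suc n))" for c i
  proof -
    have "(\<lambda>n. c (k n) j) \<longlonglongrightarrow> x j" for j
    proof -
      have "(\<lambda>n. c n j - z n j) \<longlonglongrightarrow> 0"
      proof (rule Lim_null_comparison)
        show "\<forall>\<^sub>F n in sequentially. norm (c n j - z n j) \<le> inverse (real (Suc n))"
          using eventually_gt_at_top[of i] by eventually_elim (simp add: c del: of_nat_Suc)
      qed (rule LIMSEQ_inverse_real_of_nat)
      then have "(\<lambda>n. c (k n) j - z (k n) j) \<longlonglongrightarrow> 0"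
        using LIMSEQ_subseq_LIMSEQ[OF _ k] by (fastforce simp: o_def)
      from tendsto_add[OF this coord[OF lim, of j]] show ?thesis by (simp add: o_def)
    qed
    then have *: "(\<lambda>n. c (k n)) \<longlonglongrightarrow> x"
      by (simp add: tendsto_coordinatewise_iff)
    then show ?thesis
      using continuous_on_tendsto_compose[OF cont * x] cQ by simp
  qed
  have "f x i = x i" for i
  proof -
    \<comment> \<open>The guard \<open>i < n\<close> moves under the quantifiers so that choice
      yields total sequences; for \<open>n \<le> i\<close> any point of \<open>Q\<close>, such as
      \<open>x\<close>, serves as a dummy.\<close>
    have "\<forall>n. \<exists>a\<in>Q. \<exists>b\<in>Q. i < n \<longrightarrow>
      (\<forall>j. \<bar>a j - z n j\<bar> \<le> inverse (real (Suc n))) \<and>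
      (\<forall>j. \<bar>b j - z n j\<bar> \<le> inverse (real (Suc n))) \<and> a i \<le> f a i \<and> f b i \<le> b i"
      using z x by metis
    then obtain a b where ab: "\<And>n. a n \<in> Q" "\<And>n. b n \<in> Q"
      "\<And>n. i < n \<Longrightarrow> (\<forall>j. \<bar>a n j - z n j\<bar> \<le> inverse (real (Suc n))) \<and>
      (\<forall>j. \<bar>b n j - z n j\<bar> \<le> inverse (real (Suc n))) \<and> a n i \<le> f (a n) i \<and> f (b n) i \<le> b n i"
      by metis
    have a: "(\<lambda>n. a (k n)) \<longlonglongrightarrow> x \<and> (\<lambda>n. f (a (k n))) \<longlonglongrightarrow> f x"
      by (rule flim[of a i]) (simp_all add: ab del: of_nat_Suc)
    have b: "(\<lambda>n. b (k n)) \<longlonglongrightarrow> x \<and> (\<lambda>n. f (b (k n))) \<longlonglongrightarrow> f x"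
      by (rule flim[of b i]) (simp_all add: ab del: of_nat_Suc)
    have ev: "\<forall>\<^sub>F n in sequentially. i < k n"
      using filterlim_subseq[OF k] eventually_gt_at_top[of i] by (simp add: filterlim_iff)
    have "x i \<le> f x i"
      by (rule tendsto_le[OF _ coord[OF conjunct2[OF a]] coord[OF conjunct1[OF a]]])
        (use ev ab(3) in \<open>auto elim!: eventually_mono\<close>)
    moreover have "f x i \<le> x i"
      by (rule tendsto_le[OF _ coord[OF conjunct1[OF b]] coord[OF conjunct2[OF b]]])
        (use ev ab(3) in \<open>auto elim!: eventually_mono\<close>)
    ultimately show ?thesis by simp
  qed
  then show ?thesis
    by (intro that[OF x] ext)
qed

section \<open>Limits and continuity in vector topologies\<close>

text \<open>Induction from joint continuity of scaling and addition. With \<sigma> for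
  \<open>T\<close> it makes the map from coefficients to combinations of the net sequentially
  continuous.\<close>

lemma vector_topology_limit_sum:
  fixes n :: nat
  assumes T: "vector_topology T"
    and c: "\<And>i. i < n \<Longrightarrow> ((\<lambda>k. c k i) \<longlongrightarrow> d i) F"
  shows "limitin T (\<lambda>k. \<Sum>i<n. c k i *\<^sub>R y i) (\<Sum>i<n. d i *\<^sub>R y i) F"
  using c
proof (induction n)
  case 0
  then show ?case using T by (simp add: limitin_const_iff vector_topology_def)
next
  case (Suc n)
  have scale: "continuous_map (prod_topology euclideanreal T) T (\<lambda>(c, x). c *\<^sub>R x)"
    and add: "continuous_map (prod_topology T T) T (\<lambda>(x, y). x + y)"
    using T by (auto simp: vector_topology_def)
  have "limitin (prod_topology euclideanreal T) (\<lambda>k. (c k n, y n)) (d n, y n) F"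
    using Suc.prems[of n] T by (simp add: limitin_pairwise o_def vector_topology_def)
  from continuous_map_limit[OF scale this]
  have "limitin T (\<lambda>k. c k n *\<^sub>R y n) (d n *\<^sub>R y n) F"
    by (simp add: o_def)
  then have "limitin (prod_topology T T) (\<lambda>k. (\<Sum>i<n. c k i *\<^sub>R y i, c k n *\<^sub>R y n))
     (\<Sum>i<n. d i *\<^sub>R y i, d n *\<^sub>R y n) F"
    using Suc by (simp add: limitin_pairwise o_def)
  from continuous_map_limit[OF add this] show ?case
    by (simp add: o_def)
qed

lemma continuous_map_vector_topology_diff:
  assumes T: "vector_topology T"
  shows "continuous_map (prod_topology T T) T (\<lambda>(x, y). x - y)"
proof -
  have "continuous_map (prod_topology T T) (prod_topology euclideanreal T) (\<lambda>z. (-1, snd z))"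
    by (intro continuous_map_pairedI continuous_map_snd) auto
  from continuous_map_compose[OF this, of T "\<lambda>(c, x). c *\<^sub>R x"]
  have "continuous_map (prod_topology T T) T (\<lambda>z. - snd z)"
    using T by (simp add: vector_topology_def o_def case_prod_beta)
  then have "continuous_map (prod_topology T T) (prod_topology T T) (\<lambda>z. (fst z, - snd z))"
    by (intro continuous_map_pairedI continuous_map_fst)
  from continuous_map_compose[OF this, of T "\<lambda>(x, y). x + y"] show ?thesis
    using T by (simp add: vector_topology_def o_def case_prod_unfold)
qed

section \<open>Admissible functions: seminorm rules and compactness\<close>

context
  fixes \<tau> :: "'a::real_vector topology" and C :: "'a set" and \<rho> :: "'a \<Rightarrow> ennreal"
  assumes \<rho>: "admissible_function \<tau> C \<rho>" and \<tau>: "vector_topology \<tau>"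
begin

lemma admissible_scale: "\<rho> (c *\<^sub>R x) = ennreal \<bar>c\<bar> * \<rho> x"
  and admissible_add: "\<rho> (x + y) \<le> \<rho> x + \<rho> y"
  and admissible_eq: "x \<in> C \<Longrightarrow> y \<in> C \<Longrightarrow> \<rho> (x - y) = 0 \<Longrightarrow> x = y"
  using \<rho> by (auto simp: admissible_function_def)

lemma admissible_zero: "\<rho> 0 = 0"
  using admissible_scale[of 0 0] by simp

lemma admissible_minus_commute: "\<rho> (x - y) = \<rho> (y - x)"
  using admissible_scale[of "-1" "x - y"] by simp

lemma admissible_sum: "\<rho> (\<Sum>i<n. g i) \<le> (\<Sum>i<n. \<rho> (g i))" for n :: nat
proof (induction n)
  case (Suc n)
  have "\<rho> (\<Sum>i<Suc n. g i) \<le> \<rho> (\<Sum>i<n. g i) + \<rho> (g n)"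
    by (simp add: admissible_add)
  also have "\<dots> \<le> (\<Sum>i<Suc n. \<rho> (g i))"
    using Suc by (simp add: add_right_mono)
  finally show ?case .
qed (simp add: admissible_zero)

lemma admissible_continuous_left:
  assumes "y \<in> C"
  shows "continuous_map (subtopology \<tau> C) euclidean (\<lambda>x. \<rho> (x - y))"
proof -
  have "continuous_map (subtopology \<tau> C) (prod_topology (subtopology \<tau> C) (subtopology \<tau> C)) (\<lambda>x. (x, y))"
    using assms \<tau> by (intro continuous_map_pairedI) (auto simp: vector_topology_def)
  from continuous_map_compose[OF this, of euclidean "\<lambda>(x, y). \<rho> (x - y)"] show ?thesis
    using \<rho> by (simp add: admissible_function_def o_def)
qed

text \<open>By continuity of \<open>\<rho> (x - y)\<close> in \<open>x\<close>, the \<rho>-balls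
  around points of \<open>C\<close> are relatively \<tau>-open, and they contain their centres
  because \<open>\<rho> 0 = 0\<close>; so finitely many cover \<open>C\<close>.\<close>

lemma admissible_finite_net:
  assumes C: "compactin \<tau> C" "C \<noteq> {}" and e: "e > 0"
  obtains n :: nat and y where "n > 0" "y ` {..<n} \<subseteq> C" "\<forall>x\<in>C. \<exists>i<n. \<rho> (x - y i) < e"
proof -
  define B where "B y = {x \<in> C. \<rho> (x - y) < e}" for y
  have B: "openin (subtopology \<tau> C) (B y)" if "y \<in> C" for y
  proof -
    have "openin (subtopology \<tau> C) {x \<in> topspace (subtopology \<tau> C). \<rho> (x - y) \<in> {..<e}}"
      by (rule openin_continuous_map_preimage[OF admissible_continuous_left[OF that]]) auto
    then show ?thesis
      using \<tau> by (simp add: B_def vector_topology_def)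
  qed
  have cover: "C \<subseteq> \<Union>(B ` C)"
    using e by (auto simp: B_def admissible_zero)
  have "compactin (subtopology \<tau> C) C"
    using C by (simp add: compactin_subtopology)
  from compactinD[OF this _ cover] obtain \<F> where "finite \<F>" "\<F> \<subseteq> B ` C" "C \<subseteq> \<Union>\<F>"
    using B by blast
  then obtain Y where Y: "finite Y" "Y \<subseteq> C" "C \<subseteq> \<Union>(B ` Y)"
    by (metis finite_subset_image)
  then obtain y where y: "Y = y ` {..<card Y}"
    by (metis bij_betw_imp_surj_on ex_bij_betw_nat_finite atLeast0LessThan)
  show ?thesis
  proof
    show "card Y > 0"
      using C Y by (auto simp: card_gt_0_iff)
    show "y ` {..<card Y} \<subseteq> C"
      using Y(2) y by simp
    show "\<forall>x\<in>C. \<exists>i<card Y. \<rho> (x - y i) < e"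
    proof
      fix x assume x: "x \<in> C"
      have "x \<in> \<Union>(B ` y ` {..<card Y})"
        using Y(3) x by (simp only: y[symmetric] subset_iff)
      then show "\<exists>i<card Y. \<rho> (x - y i) < e"
        by (auto simp: B_def)
    qed
  qed
qed

text \<open>The pairs from \<open>C\<close> whose difference misses \<open>U\<close> form a compact
  set \<open>?K\<close>, so the values of \<rho> on these differences form a closed set. It omits
  \<open>0\<close>, by \<open>admissible_eq\<close> and \<open>0 \<in> U\<close>, hence a whole
  interval \<open>{0..<e}\<close>.\<close>

lemma admissible_small_diff:
  assumes C: "compactin \<tau> C" and U: "openin \<tau> U" "0 \<in> U"
  obtains e where "e > 0" "\<forall>x\<in>C. \<forall>y\<in>C. \<rho> (x - y) < e \<longrightarrow> x - y \<in> U"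
proof -
  let ?P = "prod_topology (subtopology \<tau> C) (subtopology \<tau> C)"
  let ?K = "{z \<in> topspace ?P. (case z of (x, y) \<Rightarrow> x - y) \<in> topspace \<tau> - U}"
  have "continuous_map ?P \<tau> (\<lambda>(x, y). x - y)"
    using continuous_map_from_subtopology[OF continuous_map_vector_topology_diff[OF \<tau>], of "C \<times> C"]
    by (simp add: subtopology_Times)
  then have "closedin ?P ?K"
    by (rule closedin_continuous_map_preimage) (use U in auto)
  moreover have "compact_space ?P"
    using C by (simp add: compact_space_prod_topology compact_space_subtopology)
  ultimately have "compactin ?P ?K"
    by (rule closedin_compact_space[rotated])
  then have "compactin euclidean ((\<lambda>(x, y). \<rho> (x - y)) ` ?K)"
    by (rule image_compactin) (use \<rho> in \<open>simp add: admissible_function_def\<close>)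
  then have "closed ((\<lambda>(x, y). \<rho> (x - y)) ` ?K)"
    by (simp add: compact_imp_closed)
  moreover have "0 \<notin> (\<lambda>(x, y). \<rho> (x - y)) ` ?K"
  proof -
    have "\<rho> (x - y) \<noteq> 0" if "x \<in> C" "y \<in> C" "x - y \<notin> U" for x y
      using that admissible_eq[of x y] U by auto
    then show ?thesis
      by fastforce
  qed
  \<comment> \<open>The \<open>1\<close> is just some point above \<open>0\<close>, as
    \<open>open_right\<close> asks for.\<close>
  ultimately obtain e where "e > 0" and e: "{0..<e} \<subseteq> - (\<lambda>(x, y). \<rho> (x - y)) ` ?K"
    using open_right[of "- (\<lambda>(x, y). \<rho> (x - y)) ` ?K" "0::ennreal" 1] by auto
  show ?thesis
  proof
    show "e > 0" by fact
  next
    have "x - y \<in> U" if *: "x \<in> C" "y \<in> C" "\<rho> (x - y) < e" for x y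
    proof -
      from * have "\<rho> (x - y) \<in> {0..<e}" by simp
      then have "(x, y) \<notin> ?K"
        using e by (auto simp del: mem_Collect_eq)
      then show ?thesis
        using * \<tau> by (simp add: vector_topology_def)
    qed
    then show "\<forall>x\<in>C. \<forall>y\<in>C. \<rho> (x - y) < e \<longrightarrow> x - y \<in> U"
      by blast
  qed
qed

text \<open>As the weights sum to \<open>1\<close>, the difference is the weighted sum of the
  \<open>y i - z\<close>; subadditivity and homogeneity bound it by a weighted mean of
  distances.\<close>

lemma admissible_schauder_projection:
  fixes n :: nat and y :: "nat \<Rightarrow> 'a"
  assumes w: "\<And>i. i < n \<Longrightarrow> w i \<ge> 0" "(\<Sum>i<n. w i) = 1"
    and close: "\<And>i. i < n \<Longrightarrow> w i \<noteq> 0 \<Longrightarrow> \<rho> (z - y i) \<le> e"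
  shows "\<rho> ((\<Sum>i<n. w i *\<^sub>R y i) - z) \<le> e"
proof -
  have "(\<Sum>i<n. w i *\<^sub>R y i) - z = (\<Sum>i<n. w i *\<^sub>R (y i - z))"
    using w(2) by (simp add: scaleR_diff_right sum_subtractf flip: scaleR_sum_left)
  also have "\<rho> \<dots> \<le> (\<Sum>i<n. \<rho> (w i *\<^sub>R (y i - z)))"
    by (rule admissible_sum)
  also have "\<dots> \<le> (\<Sum>i<n. ennreal (w i) * e)"
  proof (rule sum_mono)
    fix i assume i: "i \<in> {..<n}"
    have "\<rho> (w i *\<^sub>R (y i - z)) = ennreal (w i) * \<rho> (z - y i)"
      using w(1)[of i] i by (simp add: admissible_scale admissible_minus_commute[of z])
    \<comment> \<open>For \<open>w i = 0\<close> nothing is known about the distance, but both sides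
      are \<open>0\<close>, even if \<rho> is infinite there.\<close>
    also have "\<dots> \<le> ennreal (w i) * e"
      using close[of i] i by (cases "w i = 0") (auto intro: mult_left_mono)
    finally show "\<rho> (w i *\<^sub>R (y i - z)) \<le> ennreal (w i) * e" .
  qed
  also have "\<dots> = e"
    using w sum_ennreal[of "{..<n}" w] by (simp flip: sum_distrib_right)
  finally show ?thesis .
qed

section \<open>Almost fixed points with respect to \<rho>\<close>

text \<open>The tolerance \<open>e\<close> is real, so \<open>ennreal e\<close> is finite: the
  weights are then real numbers, and truncated subtraction from \<open>ennreal e\<close> is
  continuous.\<close>

lemma admissible_almost_fixed_point:
  assumes C: "compactin \<tau> C" "C \<noteq> {}" "convex C" and e: "e > 0"
    and \<sigma>: "vector_topology \<sigma>"
    and f: "sequentially_continuous_map (subtopology \<sigma> C) (subtopology \<tau> C) f"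
  obtains x where "x \<in> C" "\<rho> (x - f x) \<le> ennreal e"
proof -
  have e': "ennreal e > 0"
    using e by simp
  obtain n :: nat and y where n: "n > 0" and "y ` {..<n} \<subseteq> C"
    and net: "\<forall>x\<in>C. \<exists>i<n. \<rho> (x - y i) < ennreal e"
    using admissible_finite_net[OF C(1,2) e'] by metis
  then have y: "y i \<in> C" if "i < n" for i
    using that by blast
  define Q where "Q = {t :: nat \<Rightarrow> real. \<forall>i. t i \<in> {0..1}}"
  text \<open>The truncated subtraction makes the weight vanish outside the \<open>e\<close>-ball, also where \<open>\<rho>\<close> is
    infinite, so finiteness of \<open>\<rho>\<close> is never an issue.\<close>
  define w where "w z i = enn2real (ennreal e - \<rho> (z - y i))" for z i
  define W where "W z = (\<Sum>i<n. w z i)" for z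
  define s where "s t = (\<Sum>i<n. t i)" for t :: "nat \<Rightarrow> real"
  text \<open>A retraction of the cube onto the simplex: missing mass goes to coordinate \<open>0\<close>, excess mass
    is normalised away.\<close>
  define c where "c t i = (t i + (if i = 0 then max 0 (1 - s t) else 0)) / max 1 (s t)"
    for t :: "nat \<Rightarrow> real" and i :: nat
  define x where "x t = (\<Sum>i<n. c t i *\<^sub>R y i)" for t
  \<comment> \<open>The Schauder projection after \<open>f\<close>, read in coefficients: the
    normalised weights of \<open>f (x t)\<close>, padded by \<open>0\<close> to lie in the Hilbert
    cube.\<close>
  define G where "G t i = (if i < n then w (f (x t)) i / W (f (x t)) else 0)" for t i
  have w0: "w z i \<ge> 0" for z i
    by (simp add: w_def)
  have w_eq: "ennreal (w z i) = ennreal e - \<rho> (z - y i)" for z i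
    unfolding w_def by (rule ennreal_enn2real) (meson diff_le_self_ennreal ennreal_less_top le_less_trans)
  have w_pos_iff: "w z i > 0 \<longleftrightarrow> \<rho> (z - y i) < ennreal e" for z i
  proof -
    have "w z i > 0 \<longleftrightarrow> ennreal (w z i) > 0"
      by simp
    also have "\<dots> \<longleftrightarrow> \<rho> (z - y i) < ennreal e"
      by (simp only: w_eq diff_gt_0_iff_gt_ennreal ennreal_neq_top simp_thms)
    finally show ?thesis .
  qed
  have W_pos: "W z > 0" if z: "z \<in> C" for z
  proof -
    obtain i where "i < n" "\<rho> (z - y i) < ennreal e"
      using net z by blast
    then show ?thesis
      unfolding W_def using w_pos_iff by (intro sum_pos2[of "{..<n}" i]) (simp_all add: w0)
  qed
  have topC: "topspace (subtopology \<sigma> C) = C" "topspace (subtopology \<tau> C) = C"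
    using \<sigma> \<tau> by (auto simp: vector_topology_def)
  then have fC: "f z \<in> C" if "z \<in> C" for z
    using f that by (auto simp: sequentially_continuous_map_def)
  have xC: "x t \<in> C" if "t \<in> Q" for t
    unfolding x_def
  proof (rule convex_sum[OF _ C(3)])
    \<comment> \<open>The numerators add up to \<open>s t + max 0 (1 - s t)\<close>, which equals
      the denominator; \<open>n > 0\<close> puts index \<open>0\<close> into the range.\<close>
    have "(\<Sum>i<n. t i + (if i = 0 then max 0 (1 - s t) else 0)) = max 1 (s t)"
      using n by (simp add: sum.distrib max_def flip: s_def[of t])
    then show "(\<Sum>i<n. c t i) = 1"
      by (simp add: c_def flip: sum_divide_distrib)
    show "c t i \<ge> 0" for i
      using that by (auto simp: c_def Q_def)
  qed (use y in auto)
  have w_cont: "continuous_on Q (\<lambda>t. w (f (x t)) i)" if "i < n" for i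
  \<comment> \<open>The limit is carried from coefficients by \<open>x\<close> into \<sigma>, by
    \<open>f\<close> into \<tau>, and by \<rho> into the extended half-line.\<close>
  proof (rule continuous_on_sequentiallyI)
    fix u :: "nat \<Rightarrow> nat \<Rightarrow> real" and t
    assume uQ: "\<forall>k. u k \<in> Q" and t: "t \<in> Q" and lim: "u \<longlonglongrightarrow> t"
    have "(\<lambda>k. s (u k)) \<longlonglongrightarrow> s t"
      using lim unfolding s_def tendsto_coordinatewise_iff by (intro tendsto_sum) auto
    then have "(\<lambda>k. c (u k) j) \<longlonglongrightarrow> c t j" for j
      using lim unfolding c_def tendsto_coordinatewise_iff
      by (auto intro!: tendsto_intros tendsto_max)
    then have "limitin \<sigma> (\<lambda>k. x (u k)) (x t) sequentially"
      unfolding x_def by (intro vector_topology_limit_sum \<sigma>)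
    then have "limitin (subtopology \<sigma> C) (\<lambda>k. x (u k)) (x t) sequentially"
      using uQ t xC by (simp add: limitin_subtopology)
    moreover have "range (\<lambda>k. x (u k)) \<subseteq> topspace (subtopology \<sigma> C)"
      using uQ xC topC by auto
    ultimately have "limitin (subtopology \<tau> C) (\<lambda>k. f (x (u k))) (f (x t)) sequentially"
      using f unfolding sequentially_continuous_map_def by blast
    from continuous_map_limit[OF admissible_continuous_left[OF y[OF that]] this]
    have "(\<lambda>k. \<rho> (f (x (u k)) - y i)) \<longlonglongrightarrow> \<rho> (f (x t) - y i)"
      by (simp add: o_def)
    then have "(\<lambda>k. ennreal e - \<rho> (f (x (u k)) - y i)) \<longlonglongrightarrow> ennreal e - \<rho> (f (x t) - y i)"
      by (intro tendsto_diff_ennreal_general tendsto_const) auto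
    then show "(\<lambda>k. w (f (x (u k))) i) \<longlonglongrightarrow> w (f (x t)) i"
      using w0 by (subst (asm) (1 2) w_eq[symmetric]) simp
  qed
  have "continuous_on Q G"
  proof (rule continuous_on_coordinatewise_then_product)
    fix i
    show "continuous_on Q (\<lambda>t. G t i)"
    proof (cases "i < n")
      case True
      have "W (f (x t)) \<noteq> 0" if "t \<in> Q" for t
        using W_pos[OF fC[OF xC[OF that]]] by simp
      moreover have "continuous_on Q (\<lambda>t. W (f (x t)))"
        unfolding W_def by (intro continuous_on_sum w_cont) auto
      ultimately show ?thesis
        using True by (simp add: G_def continuous_on_divide w_cont)
    qed (simp add: G_def)
  qed
  moreover have "G ` Q \<subseteq> Q"
  proof clarify
    fix t assume "t \<in> Q"
    then have "W (f (x t)) > 0" by (intro W_pos fC xC)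
    moreover have "w (f (x t)) i \<le> W (f (x t))" if "i < n" for i
      unfolding W_def using that by (intro member_le_sum) (auto simp: w0)
    ultimately show "G t \<in> Q"
      by (auto simp: Q_def G_def w0)
  qed
  ultimately obtain t where t: "t \<in> Q" "G t = t"
    by (rule brouwer_Hilbert_cube[of G, folded Q_def])
  have W: "W (f (x t)) > 0"
    by (intro W_pos fC xC t)
  have ti: "t i = w (f (x t)) i / W (f (x t))" if "i < n" for i
    using that fun_cong[OF t(2), of i] by (simp add: G_def)
  \<comment> \<open>A fixed point of \<open>G\<close> lies on the simplex, where the retraction
    \<open>c\<close> is the identity; so \<open>x t\<close> has the coefficients \<open>t\<close>
    themselves.\<close>
  then have "s t = 1"
    using W by (simp add: s_def W_def flip: sum_divide_distrib)
  then have "c t i = t i" for i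
    by (simp add: c_def)
  then have xt: "x t = (\<Sum>i<n. t i *\<^sub>R y i)"
    by (simp add: x_def)
  have "\<rho> ((\<Sum>i<n. t i *\<^sub>R y i) - f (x t)) \<le> ennreal e"
  proof (rule admissible_schauder_projection)
    show "(\<Sum>i<n. t i) = 1"
      using \<open>s t = 1\<close> by (simp add: s_def)
    show "t i \<ge> 0" for i
      using t by (simp add: Q_def)
    \<comment> \<open>A nonzero \<open>t i\<close> comes from a positive weight, and these occur
      only for net points within \<open>e\<close> of \<open>f (x t)\<close>.\<close>
    show "\<rho> (f (x t) - y i) \<le> ennreal e" if "i < n" "t i \<noteq> 0" for i
    proof -
      have "w (f (x t)) i > 0"
        using that ti[of i] w0[of "f (x t)" i] by (cases "w (f (x t)) i = 0") auto
      then show ?thesis by (simp add: w_pos_iff)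
    qed
  qed
  then show ?thesis
    using that xC[OF t(1)] xt by simp
qed

end

section \<open>Passage from \<rho>-small to \<tau>-small differences\<close>

theorem theorem2p2:
  fixes \<tau> :: "'a::real_vector topology" and C :: "'a set"
  assumes "hausdorff_vector_topology \<tau>"
    and "C \<noteq> {}" and "compactin \<tau> C" and "convex C"
    and "\<exists>\<rho>. admissible_function \<tau> C \<rho>"
  shows "approximate_fixed_point_property \<tau> C"
  unfolding approximate_fixed_point_property_def
proof (intro allI impI)
  fix \<sigma> f
  assume \<sigma>: "hausdorff_vector_topology \<sigma>"
    and f: "sequentially_continuous_map (subtopology \<sigma> C) (subtopology \<tau> C) f"
  obtain \<rho> where \<rho>: "admissible_function \<tau> C \<rho>"
    using assms(5) by blast
  have \<tau>: "vector_topology \<tau>" and \<sigma>': "vector_topology \<sigma>"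
    using assms(1) \<sigma> by (auto simp: hausdorff_vector_topology_def)
  have fC: "f x \<in> C" if "x \<in> C" for x
    using f that \<sigma>' \<tau> by (auto simp: sequentially_continuous_map_def vector_topology_def)
  have "\<exists>x\<in>C. \<rho> (x - f x) \<le> ennreal (inverse (real (Suc n)))" for n
    by (rule admissible_almost_fixed_point[OF \<rho> \<tau> assms(3,2,4) _ \<sigma>' f, of "inverse (real (Suc n))"])
      auto
  then obtain u where u: "\<And>n. u n \<in> C"
    "\<And>n. \<rho> (u n - f (u n)) \<le> ennreal (inverse (real (Suc n)))"
    by metis
  have "(\<lambda>n. ennreal (inverse (real (Suc n)))) \<longlonglongrightarrow> ennreal 0"
    by (intro tendsto_ennrealI LIMSEQ_inverse_real_of_nat)
  then have inv: "(\<lambda>n. ennreal (inverse (real (Suc n)))) \<longlonglongrightarrow> 0"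
    by (simp del: of_nat_Suc)
  have "limitin \<tau> (\<lambda>n. u n - f (u n)) 0 sequentially"
    unfolding limitin_def
  proof (intro conjI allI impI)
    show "0 \<in> topspace \<tau>"
      using \<tau> by (simp add: vector_topology_def)
    fix U assume "openin \<tau> U \<and> 0 \<in> U"
    then have U: "openin \<tau> U" "0 \<in> U" by auto
    \<comment> \<open>Since \<open>u n\<close> and \<open>f (u n)\<close> both lie in
      \<open>C\<close>, a \<rho>-small difference of the two must fall into
      \<open>U\<close>.\<close>
    obtain e where "e > 0" and e: "\<forall>x\<in>C. \<forall>y\<in>C. \<rho> (x - y) < e \<longrightarrow> x - y \<in> U"
      using admissible_small_diff[OF \<rho> \<tau> assms(3) U] by metis
    have "\<forall>\<^sub>F n in sequentially. ennreal (inverse (real (Suc n))) < e"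
      using order_tendstoD(2)[OF inv \<open>e > 0\<close>] .
    then show "\<forall>\<^sub>F n in sequentially. u n - f (u n) \<in> U"
      by eventually_elim (use e u fC in \<open>blast intro: le_less_trans\<close>)
  qed
  then show "\<exists>u::nat \<Rightarrow> 'a. range u \<subseteq> C \<and> limitin \<tau> (\<lambda>n. u n - f (u n)) 0 sequentially"
    using u by blast
qed

end
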